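(* Let $1/q$ be a prime power, $\Bbbk=\mathbb{F}_{1/q}$, $n=4$, $\alpha=\beta=(1,1,1,1)$. Let $M$ and $M'$ be the $4\times4$ permutation matrices of $3412$ and $1432$ respectively (note $M_{4,4}=M'_{4,4}=0$). Let $G(M)$ be the random growth diagram obtained from a uniformly random $(F,F',N)\in\Omega_M$, and similarly $G(M')$. Conditioned on $G(M)_{3,3}=(2)$, $G(M)_{3,4}=G(M)_{4,3}=(2,1)$, we have $G(M)_{4,4}=(2,2)$ with probability $1$; conditioned on $G(M')_{3,3}=(2)$, $G(M')_{3,4}=G(M')_{4,3}=(2,1)$, we have $G(M')_{4,4}=(3,1)$ with probability $1$. In particular, the distribution of the entry $(i,j)$ of the growth diagram is not determined by the entries at $(i-1,j-1),(i-1,j),(i,j-1)$ together with $M_{i,j}$.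
   Context: Permutation matrix of $w\in S_4$: $\mathring{w}_{a,b}=\delta_{a,w(b)}$. $\mathrm{Fl}_{(1,1,1,1)}$: complete flags $0=F_0\subset F_1\subset\cdots\subset F_4=\Bbbk^4$; $(F,F')$ has relative position $M$ if $\dim(F_i\cap F'_j)=\sum_{i'\le i,j'\le j}M_{i',j'}$. $N\in\mathfrak{gl}_4$ is strictly compatible with $F$ if $N(F_i)\subseteq F_{i-1}$. $\Omega_M$: set of triples $(F,F',N)$ of complete flags of relative position $M$ and $N$ strictly compatible with both. The growth diagram of $(F,F',N)$ is the $5\times5$ array of partitions $G_{i,j}=\mathrm{JF}(N|_{F_i\cap F'_j})$, $0\le i,j\le4$, where for nilpotent $N$, $\mathrm{JF}(N)$ is the partition with $\lambda_1+\cdots+\lambda_i=\dim\ker N^i$. *)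

theory Defs
  imports "HOL-Analysis.Analysis" "HOL-Computational_Algebra.Primes"
begin

text \<open>Vectors of k^4 are elements of type 'k^4, matrices N in gl_4 are of type 'k^4^4,
  acting by N *v x.  Subspace dimension is the dimension over the field 'k (vec.dim).\<close>

text \<open>Complete flag 0 = F_0 < F_1 < ... < F_4 = k^4, given as F :: nat => subspace
  (only indices 0..4 matter).\<close>
definition complete_flag :: "(nat \<Rightarrow> ('k::field^4) set) \<Rightarrow> bool" where
  "complete_flag F \<longleftrightarrow>
     (\<forall>i\<le>4. vec.subspace (F i) \<and> vec.dim (F i) = i) \<and>
     (\<forall>i<4. F i \<subseteq> F (Suc i)) \<and> F 0 = {0} \<and> F 4 = UNIV"

text \<open>Permutation matrix of w in S_4: entry (a,b) is delta_{a, w(b)}; indices 1..4.\<close>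
definition perm_mat :: "(nat \<Rightarrow> nat) \<Rightarrow> nat \<Rightarrow> nat \<Rightarrow> nat" where
  "perm_mat w a b = (if a = w b then 1 else 0)"

text \<open>The permutation given in one-line notation [w(1), w(2), w(3), w(4)].\<close>
definition one_line :: "nat list \<Rightarrow> nat \<Rightarrow> nat" where
  "one_line ws b = ws ! (b - 1)"

text \<open>(F,F') has relative position M: dim(F_i \<inter> F'_j) = sum_{i'<=i, j'<=j} M_{i',j'}.\<close>
definition rel_pos :: "(nat \<Rightarrow> nat \<Rightarrow> nat) \<Rightarrow> (nat \<Rightarrow> ('k::field^4) set) \<Rightarrow>
    (nat \<Rightarrow> ('k^4) set) \<Rightarrow> bool" where
  "rel_pos M F F' \<longleftrightarrow>
     (\<forall>i\<le>4. \<forall>j\<le>4. vec.dim (F i \<inter> F' j) = (\<Sum>i'\<in>{1..i}. \<Sum>j'\<in>{1..j}. M i' j'))"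

text \<open>N strictly compatible with F: N(F_i) \<subseteq> F_{i-1} for i = 1..4.\<close>
definition strictly_compatible :: "('k::field^4^4) \<Rightarrow> (nat \<Rightarrow> ('k^4) set) \<Rightarrow> bool" where
  "strictly_compatible N F \<longleftrightarrow> (\<forall>i\<in>{1..4}. (\<lambda>x. N *v x) ` F i \<subseteq> F (i - 1))"

text \<open>Omega_M: triples (F, F', N).\<close>
definition Omega :: "(nat \<Rightarrow> nat \<Rightarrow> nat) \<Rightarrow>
    ((nat \<Rightarrow> ('k::field^4) set) \<times> (nat \<Rightarrow> ('k^4) set) \<times> ('k^4^4)) set" where
  "Omega M = {(F, F', N). complete_flag F \<and> complete_flag F' \<and> rel_pos M F F' \<and>
                strictly_compatible N F \<and> strictly_compatible N F'}"

text \<open>dim ker (N|_V)^i for an N-stable subspace V.\<close>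
definition ker_dim :: "('k::field^4^4) \<Rightarrow> ('k^4) set \<Rightarrow> nat \<Rightarrow> nat" where
  "ker_dim N V i = vec.dim {v \<in> V. ((\<lambda>x. N *v x) ^^ i) v = 0}"

text \<open>Jordan form JF(N|_V) of a nilpotent restriction: the partition lambda with
  lambda_1 + ... + lambda_i = dim ker (N|_V)^i, i.e. lambda_i = dim ker^i - dim ker^(i-1),
  listed as the list of its nonzero parts (lambda_1, lambda_2, ...).\<close>
definition JF :: "('k::field^4^4) \<Rightarrow> ('k^4) set \<Rightarrow> nat list" where
  "JF N V = filter (\<lambda>l. l > 0)
      (map (\<lambda>i. ker_dim N V i - ker_dim N V (i - 1)) [1..<vec.dim V + 1])"

text \<open>Growth diagram entry G_{i,j} = JF(N|_{F_i \<inter> F'_j}).\<close>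
definition growth :: "(nat \<Rightarrow> ('k::field^4) set) \<Rightarrow> (nat \<Rightarrow> ('k^4) set) \<Rightarrow> ('k^4^4) \<Rightarrow>
    nat \<Rightarrow> nat \<Rightarrow> nat list" where
  "growth F F' N i j = JF N (F i \<inter> F' j)"

end

theory Submission
  imports Defs
begin

text \<open>
  Both conditional statements hold for every triple, over any field. If
  \<open>G\<^sub>3\<^sub>4 = G\<^sub>4\<^sub>3 = (2,1)\<close>, then \<open>N\<^sup>2\<close> vanishes on the hyperplanes \<open>F\<^sub>3\<close> and \<open>F'\<^sub>3\<close>; as \<open>M\<^sub>4\<^sub>4 = 0\<close>
  they meet in a plane, so they span \<open>\<Bbbk>\<^sup>4\<close> and \<open>N\<^sup>2 = 0\<close>. Hence \<open>G\<^sub>4\<^sub>4 = (k, 4 - k)\<close> with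
  \<open>k = dim ker N\<close>. For \<open>3412\<close>, \<open>N\<close> kills the plane \<open>F\<^sub>3 \<inter> F'\<^sub>3\<close> (it maps it into
  \<open>F\<^sub>2 \<inter> F'\<^sub>2 = 0\<close>), while \<open>N F\<^sub>3 \<subseteq> F\<^sub>2\<close> and \<open>N F'\<^sub>3 \<subseteq> F'\<^sub>2\<close> are independent lines;
  so \<open>k = 2\<close>. For \<open>1432\<close>, the whole image of \<open>N\<close> lies in the line \<open>F\<^sub>1 = F'\<^sub>1\<close>, so \<open>k = 3\<close>.
  Coordinate flags with explicit square-zero matrices show that the conditioning events are
  non-empty, i.e. have positive probability.
\<close>

section \<open>Linear algebra in \<open>\<Bbbk>\<^sup>n\<close>\<close>

lemma linear_matrix_iterate: "Vector_Spaces.linear (*s) (*s) (((*v) (N::'a::field^'n^'n)) ^^ i)"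
proof (induction i)
  case 0
  show ?case unfolding funpow.simps(1) by (rule vec.linear_id)
next
  case (Suc i)
  then show ?case unfolding funpow.simps(2) by (rule Vector_Spaces.linear_compose) simp
qed

lemma matrix_iterate_zero [simp]: "(((*v) (N::'a::field^'n^'n)) ^^ i) 0 = 0"
  using vec.linear_0[OF linear_matrix_iterate] .

lemma subspace_kernel_on:
  assumes f: "Vector_Spaces.linear (*s) (*s) (f :: 'a::field^'n \<Rightarrow> 'a^'m)"
    and V: "vec.subspace V"
  shows "vec.subspace {v \<in> V. f v = 0}"
proof -
  have "{v \<in> V. f v = 0} = V \<inter> {v. f v = 0}" by blast
  then show ?thesis using vec.subspace_inter[OF V vec.linear_subspace_kernel[OF f]] by simp
qed

lemma sum_decomposition_by_dim:
  fixes A B :: "('a::field^'n) set"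
  assumes A: "vec.subspace A" and B: "vec.subspace B"
    and dims: "vec.dim A + vec.dim B = CARD('n) + vec.dim (A \<inter> B)"
  shows "\<exists>a\<in>A. \<exists>b\<in>B. v = a + b"
proof -
  let ?S = "{a + b |a b. a \<in> A \<and> b \<in> B}"
  have "vec.dim ?S = vec.dim (UNIV :: ('a^'n) set)"
    using vec.dim_sums_Int[OF A B] dims by (simp add: vec_dim_card del: vec.dim_UNIV)
  then have "?S = UNIV"
    using vec.subspace_dim_equal[OF vec.subspace_sums[OF A B] vec.subspace_UNIV] by simp
  then show ?thesis by blast
qed

lemma complement_subspace_exists:
  assumes V: "vec.subspace V" and K: "vec.subspace K" "K \<subseteq> V"
  obtains U :: "('a::field^'n) set"
  where "vec.subspace U" "U \<subseteq> V" "U \<inter> K \<subseteq> {0}" "V = {u + k |u k. u \<in> U \<and> k \<in> K}"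
proof -
  obtain B where B: "B \<subseteq> K" "vec.independent B" "K \<subseteq> vec.span B" "card B = vec.dim K"
    using vec.basis_exists by blast
  obtain C where C: "B \<subseteq> C" "C \<subseteq> V" "vec.independent C" "V \<subseteq> vec.span C"
    using vec.maximal_independent_subset_extend[of B V] B K(2) by blast
  have "finite C" using C(3) vec.finiteI_independent by blast
  then have card_C: "card C = card B + card (C - B)"
    using C(1) by (metis card_Diff_subset finite_subset add_diff_inverse_nat card_mono not_less)
  define U where "U = vec.span (C - B)"
  have U: "vec.subspace U" "U \<subseteq> V" "vec.dim U = card (C - B)"
    unfolding U_def using C vec.span_minimal[of "C - B" V] V
      vec.dim_span_eq_card_independent[OF vec.independent_mono[OF C(3)]] by auto
  define S where "S = {u + k |u k. u \<in> U \<and> k \<in> K}"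
  have "C \<subseteq> S"
  proof
    fix c assume "c \<in> C"
    then have "c \<in> K \<or> c \<in> U" using B(1) unfolding U_def by (auto intro: vec.span_base)
    then show "c \<in> S" unfolding S_def using vec.subspace_0[OF U(1)] vec.subspace_0[OF K(1)] by force
  qed
  then have "V \<subseteq> S" using C(4) vec.span_minimal vec.subspace_sums[OF U(1) K(1)] unfolding S_def by blast
  then have V_eq: "V = S" unfolding S_def using U(2) K(2) vec.subspace_add[OF V] by blast
  have "vec.dim V = card C" using vec.basis_card_eq_dim[OF C(2) C(4) C(3)] by simp
  then have "vec.dim (U \<inter> K) = 0"
    using vec.dim_sums_Int[OF U(1) K(1)] V_eq U(3) B(4) card_C unfolding S_def by simp
  then show thesis using that[OF U(1,2)] V_eq unfolding S_def by simp
qed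

lemma dim_image_add_dim_kernel:
  fixes f :: "'a::field^'n \<Rightarrow> 'a^'m"
  assumes f: "Vector_Spaces.linear (*s) (*s) f" and V: "vec.subspace V"
  shows "vec.dim (f ` V) + vec.dim {v \<in> V. f v = 0} = vec.dim V"
proof -
  define K where "K = {v \<in> V. f v = 0}"
  have K: "vec.subspace K" "K \<subseteq> V"
    unfolding K_def using subspace_kernel_on[OF f V] by auto
  obtain U where U: "vec.subspace U" "U \<subseteq> V" "U \<inter> K \<subseteq> {0}"
    and V_eq: "V = {u + k |u k. u \<in> U \<and> k \<in> K}"
    using complement_subspace_exists[OF V K] by blast
  have "vec.dim (U \<inter> K) = 0" using U(3) by simp
  then have dim_V: "vec.dim V = vec.dim U + vec.dim K"
    using vec.dim_sums_Int[OF U(1) K(1)] unfolding V_eq[symmetric] by linarith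
  have "inj_on f U"
  proof (rule inj_onI)
    fix x y assume "x \<in> U" "y \<in> U" "f x = f y"
    then have "x - y \<in> U" "f (x - y) = 0"
      using vec.subspace_diff[OF U(1)] vec.linear_diff[OF f] by auto
    then have "x - y \<in> U \<inter> K" unfolding K_def using U(2) by blast
    then show "x = y" using U(3) by auto
  qed
  then have "vec.dim (f ` U) = vec.dim U"
    using vec.dim_image_eq[OF f] vec.span_eq_iff[THEN iffD2, OF U(1)] by metis
  moreover have "f ` V = f ` U"
  proof
    show "f ` V \<subseteq> f ` U"
    proof
      fix z assume "z \<in> f ` V"
      then obtain u k where "z = f (u + k)" "u \<in> U" "k \<in> K" using V_eq by blast
      then show "z \<in> f ` U" unfolding K_def using vec.linear_add[OF f] by auto
    qed
  qed (use U(2) in blast)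
  ultimately show ?thesis unfolding K_def[symmetric] using dim_V by simp
qed

section \<open>Kernel dimensions and Jordan type\<close>

lemma ker_dim_0: "vec.subspace V \<Longrightarrow> ker_dim N V 0 = 0"
  by (auto simp: ker_dim_def)

lemma ker_dim_1: "ker_dim N V 1 = vec.dim {v \<in> V. N *v v = 0}"
  by (simp add: ker_dim_def)

lemma ker_dim_mono: "i \<le> j \<Longrightarrow> ker_dim N V i \<le> ker_dim N V j"
  unfolding ker_dim_def
proof (rule vec.dim_subset, safe)
  fix v assume "i \<le> j" "((*v) N ^^ i) v = 0"
  then show "((*v) N ^^ j) v = 0"
    using funpow_add[of "j - i" i "(*v) N"] by simp
qed

lemma ker_dim_eq_dim_iff:
  assumes V: "vec.subspace V"
  shows "ker_dim N V i = vec.dim V \<longleftrightarrow> (\<forall>v\<in>V. ((*v) N ^^ i) v = 0)"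
proof
  assume "ker_dim N V i = vec.dim V"
  then have "{v \<in> V. ((*v) N ^^ i) v = 0} = V"
    using vec.subspace_dim_equal[OF subspace_kernel_on[OF linear_matrix_iterate V] V]
    unfolding ker_dim_def by auto
  then show "\<forall>v\<in>V. ((*v) N ^^ i) v = 0" by blast
next
  assume "\<forall>v\<in>V. ((*v) N ^^ i) v = 0"
  then have "{v \<in> V. ((*v) N ^^ i) v = 0} = V" by blast
  then show "ker_dim N V i = vec.dim V" by (simp add: ker_dim_def)
qed

text \<open>Once the kernels of \<open>N|\<^sub>V\<^sup>i\<close> stop growing they stay constant, since
  \<open>N\<^sup>i\<^sup>+\<^sup>2 v = 0\<close> says \<open>N v \<in> ker N\<^sup>i\<^sup>+\<^sup>1 = ker N\<^sup>i\<close>.\<close>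
lemma ker_dim_Suc_stable:
  assumes V: "vec.subspace V" "\<forall>v\<in>V. N *v v \<in> V"
    and eq: "ker_dim N V i = ker_dim N V (Suc i)"
  shows "ker_dim N V (Suc i) = ker_dim N V (Suc (Suc i))"
proof -
  define K where "K j = {v \<in> V. ((*v) N ^^ j) v = 0}" for j
  have K_subspace: "vec.subspace (K j)" for j
    unfolding K_def by (rule subspace_kernel_on[OF linear_matrix_iterate V(1)])
  have K_Suc: "K j \<subseteq> K (Suc j)" for j
    unfolding K_def by (simp add: subset_iff)
  have "K i = K (Suc i)"
    using vec.subspace_dim_equal[OF K_subspace K_subspace K_Suc[of i]] eq
    unfolding ker_dim_def K_def by simp
  have "K (Suc (Suc i)) \<subseteq> K (Suc i)"
  proof
    fix v assume v: "v \<in> K (Suc (Suc i))"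
    then have "N *v v \<in> K (Suc i)"
      using V(2) unfolding K_def by (simp add: funpow_Suc_right del: funpow.simps)
    then have "N *v v \<in> K i" using \<open>K i = K (Suc i)\<close> by blast
    then show "v \<in> K (Suc i)" using v unfolding K_def by (simp add: funpow_Suc_right del: funpow.simps)
  qed
  then have "K (Suc i) = K (Suc (Suc i))" using K_Suc[of "Suc i"] by blast
  then show ?thesis unfolding ker_dim_def K_def by simp
qed

lemma ker_dim_constant_after:
  assumes V: "vec.subspace V" "\<forall>v\<in>V. N *v v \<in> V"
    and eq: "ker_dim N V i = ker_dim N V (Suc i)" and "i \<le> j"
  shows "ker_dim N V j = ker_dim N V i"
proof -
  have Suc_eq: "ker_dim N V (Suc k) = ker_dim N V k" if "i \<le> k" for k
    using that
  proof (induction k rule: dec_induct)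
    case base
    show ?case using eq by simp
  next
    case (step k)
    show ?case using ker_dim_Suc_stable[OF V step.IH[symmetric]] by simp
  qed
  show ?thesis
    using \<open>i \<le> j\<close> by (induction j rule: dec_induct) (simp_all add: Suc_eq)
qed

lemma sum_list_ker_dim_differences:
  assumes "vec.subspace V"
  shows "sum_list (map (\<lambda>j. ker_dim N V j - ker_dim N V (j - 1)) [1..<i + 1]) = ker_dim N V i"
proof (induction i)
  case 0
  show ?case using ker_dim_0[OF assms] by simp
next
  case (Suc i)
  then show ?case using ker_dim_mono[of i "Suc i" N V] by simp
qed

text \<open>\<open>\<lambda>\<^sub>1 + \<dots> + \<lambda>\<^sub>i = dim ker (N|\<^sub>V)\<^sup>i\<close>. \<open>JF\<close> drops the zero differences, but by
  \<open>ker_dim_constant_after\<close> they all come after the nonzero ones, so the prefix sums survive.\<close>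
lemma sum_list_take_JF:
  assumes V: "vec.subspace V" "\<forall>v\<in>V. N *v v \<in> V" and i: "i \<le> length (JF N V)"
  shows "sum_list (take i (JF N V)) = ker_dim N V i"
proof -
  define D where "D j = ker_dim N V j - ker_dim N V (j - 1)" for j
  define xs where "xs = map D [1..<vec.dim V + 1]"
  have JF_eq: "JF N V = filter ((<) 0) xs"
    unfolding JF_def xs_def D_def by simp
  have len_xs: "length xs = vec.dim V" unfolding xs_def by (simp del: upt_Suc)
  have nth_xs: "xs ! l = D (Suc l)" if "l < length xs" for l
    using that unfolding xs_def by (simp del: upt_Suc)
  let ?m = "length (takeWhile ((<) 0) xs)"
  have "x = 0" if x: "x \<in> set (dropWhile ((<) 0) xs)" for x
  proof -
    have drop: "dropWhile ((<) 0) xs = drop ?m xs" by (rule dropWhile_eq_drop)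
    then obtain l where l: "?m \<le> l" "l < length xs" "x = xs ! l"
      using x by (auto simp: in_set_conv_nth) (metis le_add1 less_diff_conv add.commute)
    have "\<not> 0 < xs ! ?m"
      using hd_dropWhile[of "(<) 0" xs] x l by (auto simp: drop hd_drop_conv_nth)
    then have "ker_dim N V ?m = ker_dim N V (Suc ?m)"
      using l nth_xs[of ?m] ker_dim_mono[of ?m "Suc ?m" N V] by (simp add: D_def)
    then have "ker_dim N V (Suc l) = ker_dim N V l"
      using ker_dim_constant_after[OF V] l(1) by (metis le_SucI)
    then show "x = 0" using l nth_xs by (simp add: D_def)
  qed
  then have "JF N V = takeWhile ((<) 0) xs"
    unfolding JF_eq by (metis takeWhile_eq_filter less_irrefl)
  then have "take i (JF N V) = take i xs"
    using i takeWhile_eq_take[of "(<) 0" xs] by (metis min.absorb1 take_take)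
  moreover have "i \<le> vec.dim V"
    using i length_filter_le[of "(<) 0" xs] len_xs unfolding JF_eq by simp
  then have "take i xs = map D [1..<i + 1]"
    unfolding xs_def by (simp add: take_map take_upt del: upt_Suc)
  ultimately show ?thesis
    using sum_list_ker_dim_differences[OF V(1), of N i] unfolding D_def by simp
qed

lemma JF_square_zero:
  assumes V: "vec.subspace V" and dim: "2 \<le> vec.dim V"
    and sq: "\<forall>v\<in>V. N *v (N *v v) = 0"
  shows "JF N V = filter ((<) 0) [ker_dim N V 1, vec.dim V - ker_dim N V 1]"
proof -
  have full: "ker_dim N V j = vec.dim V" if "2 \<le> j" for j
  proof -
    have "(*v) N ^^ j = (*v) N ^^ (j - 2) \<circ> (*v) N ^^ 2"
      by (metis funpow_add le_add_diff_inverse2 that)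
    then have "((*v) N ^^ j) v = ((*v) N ^^ (j - 2)) (N *v (N *v v))" for v
      by (simp add: numeral_2_eq_2)
    then show ?thesis using sq ker_dim_eq_dim_iff[OF V] by simp
  qed
  have "[1..<vec.dim V + 1] = 1 # 2 # [3..<vec.dim V + 1]"
    using dim by (simp add: upt_conv_Cons numeral_3_eq_3 del: upt_Suc)
  moreover have "filter ((<) 0) (map (\<lambda>j. ker_dim N V j - ker_dim N V (j - 1)) [3..<vec.dim V + 1]) = []"
    using full by (auto simp: filter_empty_conv simp del: upt_Suc)
  moreover have "\<not> V \<subseteq> {0}"
    using dim vec.dim_eq_0[of V] by linarith
  ultimately show ?thesis
    unfolding JF_def using ker_dim_0[OF V, of N] full[of 2] by (simp del: upt_Suc)
qed

lemma JF_eq_2_1D: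
  assumes V: "vec.subspace V" "\<forall>v\<in>V. N *v v \<in> V" and dim: "vec.dim V = 3"
    and JF: "JF N V = [2, 1]"
  shows "vec.dim {v \<in> V. N *v v = 0} = 2" and "\<forall>v\<in>V. N *v (N *v v) = 0"
proof -
  show "vec.dim {v \<in> V. N *v v = 0} = 2"
    using sum_list_take_JF[OF V, of 1] JF ker_dim_1[of N V] by simp
  have "ker_dim N V 2 = vec.dim V"
    using sum_list_take_JF[OF V, of 2] JF dim by simp
  then show "\<forall>v\<in>V. N *v (N *v v) = 0"
    using ker_dim_eq_dim_iff[OF V(1)] by (simp add: numeral_2_eq_2)
qed

lemma JF_eq_2D:
  assumes V: "vec.subspace V" "\<forall>v\<in>V. N *v v \<in> V" and dim: "vec.dim V = 2"
    and JF: "JF N V = [2]"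
  shows "\<forall>v\<in>V. N *v v = 0"
proof -
  have "ker_dim N V 1 = vec.dim V"
    using sum_list_take_JF[OF V, of 1] JF dim by simp
  then show ?thesis using ker_dim_eq_dim_iff[OF V(1)] by simp
qed

section \<open>Flags and strictly compatible nilpotents\<close>

lemma complete_flagD:
  assumes "complete_flag F" and "i \<le> 4"
  shows "vec.subspace (F i)" and "vec.dim (F i) = i"
  using assms unfolding complete_flag_def by auto

lemma complete_flag_top: "complete_flag F \<Longrightarrow> F 4 = UNIV"
  unfolding complete_flag_def by simp

lemma complete_flag_mono:
  assumes F: "complete_flag F" and "i \<le> j" and "j \<le> 4"
  shows "F i \<subseteq> F j"
  using \<open>i \<le> j\<close> \<open>j \<le> 4\<close>
proof (induction j rule: dec_induct)
  case base
  show ?case by simp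
next
  case (step j)
  have "F j \<subseteq> F (Suc j)" using F step.prems unfolding complete_flag_def by simp
  then show ?case using step.IH step.prems by simp
qed

lemma strictly_compatibleD:
  "strictly_compatible N F \<Longrightarrow> 1 \<le> i \<Longrightarrow> i \<le> 4 \<Longrightarrow> x \<in> F i \<Longrightarrow> N *v x \<in> F (i - 1)"
  unfolding strictly_compatible_def by (metis atLeastAtMost_iff image_subset_iff)

lemma strictly_compatible_stable:
  assumes F: "complete_flag F" and N: "strictly_compatible N F" and i: "i \<le> 4"
  shows "\<forall>x\<in>F i. N *v x \<in> F i"
proof
  fix x assume x: "x \<in> F i"
  show "N *v x \<in> F i"
  proof (cases "i = 0")
    case True
    then show ?thesis using F x unfolding complete_flag_def by simp
  next
    case False
    then have "N *v x \<in> F (i - 1)" using strictly_compatibleD[OF N _ i x] by simp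
    then show ?thesis using complete_flag_mono[OF F, of "i - 1" i] i by auto
  qed
qed

lemma OmegaD:
  assumes "(F, F', N) \<in> Omega M"
  shows "complete_flag F" "complete_flag F'" "rel_pos M F F'"
    "strictly_compatible N F" "strictly_compatible N F'"
  using assms unfolding Omega_def by auto

lemma rel_posD:
  "rel_pos M F F' \<Longrightarrow> i \<le> 4 \<Longrightarrow> j \<le> 4 \<Longrightarrow>
    vec.dim (F i \<inter> F' j) = (\<Sum>i'\<in>{1..i}. \<Sum>j'\<in>{1..j}. M i' j')"
  unfolding rel_pos_def by simp

lemma rel_pos_dim_3412:
  assumes "rel_pos (perm_mat (one_line [3,4,1,2])) F F'"
  shows "vec.dim (F 2 \<inter> F' 2) = 0" "vec.dim (F 3 \<inter> F' 3) = 2"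
  using rel_posD[OF assms, of 2 2] rel_posD[OF assms, of 3 3]
  by (simp_all add: perm_mat_def one_line_def eval_nat_numeral sum.atLeast_Suc_atMost)

lemma rel_pos_dim_1432:
  assumes "rel_pos (perm_mat (one_line [1,4,3,2])) F F'"
  shows "vec.dim (F 1 \<inter> F' 1) = 1" "vec.dim (F 1 \<inter> F' 3) = 1" "vec.dim (F 2 \<inter> F' 3) = 1"
    "vec.dim (F 3 \<inter> F' 2) = 1" "vec.dim (F 3 \<inter> F' 3) = 2"
  using rel_posD[OF assms, of 1 1] rel_posD[OF assms, of 1 3] rel_posD[OF assms, of 2 3]
    rel_posD[OF assms, of 3 2] rel_posD[OF assms, of 3 3]
  by (simp_all add: perm_mat_def one_line_def eval_nat_numeral sum.atLeast_Suc_atMost)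

lemma growth_at_top:
  assumes "complete_flag F" "complete_flag F'"
  shows "growth F F' N i 4 = JF N (F i)" "growth F F' N 4 j = JF N (F' j)"
  using complete_flag_top[OF assms(1)] complete_flag_top[OF assms(2)] by (simp_all add: growth_def)

lemma complete_flag_JF_eq_2_1D:
  assumes F: "complete_flag F" and N: "strictly_compatible N F" and JF: "JF N (F 3) = [2, 1]"
  shows "vec.dim {v \<in> F 3. N *v v = 0} = 2" and "\<forall>v\<in>F 3. N *v (N *v v) = 0"
  using JF_eq_2_1D[OF _ _ _ JF] complete_flagD[OF F, of 3] strictly_compatible_stable[OF F N, of 3]
  by simp_all

section \<open>The entry \<open>G\<^sub>4\<^sub>4\<close>\<close>

lemma growth_44_eq_kernel_dim:
  assumes om: "(F, F', N) \<in> Omega M" and d33: "vec.dim (F 3 \<inter> F' 3) = 2"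
    and g34: "growth F F' N 3 4 = [2, 1]" and g43: "growth F F' N 4 3 = [2, 1]"
  shows "growth F F' N 4 4 = filter ((<) 0) [vec.dim {v. N *v v = 0}, 4 - vec.dim {v. N *v v = 0}]"
proof -
  note flags = OmegaD(1,2)[OF om] and compatible = OmegaD(4,5)[OF om]
  have "\<forall>v\<in>F 3. N *v (N *v v) = 0" "\<forall>v\<in>F' 3. N *v (N *v v) = 0"
    using complete_flag_JF_eq_2_1D(2)[OF flags(1) compatible(1)]
      complete_flag_JF_eq_2_1D(2)[OF flags(2) compatible(2)] g34 g43 growth_at_top[OF flags]
    by simp_all
  moreover have "\<exists>a\<in>F 3. \<exists>b\<in>F' 3. v = a + b" for v
    by (rule sum_decomposition_by_dim)
      (simp_all add: complete_flagD[OF flags(1)] complete_flagD[OF flags(2)] d33)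
  ultimately have square_zero: "\<forall>v. N *v (N *v v) = 0"
    by (metis matrix_vector_right_distrib add_0)
  have dim_full: "vec.dim (UNIV :: ('a^4) set) = 4" by (simp add: vec_dim_card del: vec.dim_UNIV)
  have "JF N UNIV = filter ((<) 0) [ker_dim N UNIV 1, vec.dim (UNIV :: ('a^4) set) - ker_dim N UNIV 1]"
    by (rule JF_square_zero) (use square_zero dim_full in \<open>simp_all del: vec.dim_UNIV\<close>)
  then show ?thesis
    unfolding growth_def complete_flag_top[OF flags(1)] complete_flag_top[OF flags(2)] ker_dim_1 dim_full
    by simp
qed

lemma dim_range_add_dim_kernel:
  "vec.dim ((*v) N ` UNIV) + vec.dim {v. N *v v = 0} = 4" for N :: "'a::field^4^4"
  using dim_image_add_dim_kernel[OF matrix_vector_mul_linear_gen vec.subspace_UNIV, of N]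
  by (simp add: vec_dim_card del: vec.dim_UNIV)

lemma growth_44_3412:
  assumes om: "(F, F', N) \<in> Omega (perm_mat (one_line [3,4,1,2]))"
    and g34: "growth F F' N 3 4 = [2, 1]" and g43: "growth F F' N 4 3 = [2, 1]"
  shows "growth F F' N 4 4 = [2, 2]"
proof -
  note flags = OmegaD(1,2)[OF om] and compatible = OmegaD(4,5)[OF om]
  note dims = rel_pos_dim_3412[OF OmegaD(3)[OF om]]
  have F3: "vec.subspace (F 3)" "vec.dim (F 3) = 3" "vec.subspace (F' 3)" "vec.dim (F' 3) = 3"
    using complete_flagD[OF flags(1)] complete_flagD[OF flags(2)] by auto
  have into2: "N *v x \<in> F 2" if "x \<in> F 3" for x
    using strictly_compatibleD[OF compatible(1) _ _ that] by simp
  have into2': "N *v x \<in> F' 2" if "x \<in> F' 3" for x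
    using strictly_compatibleD[OF compatible(2) _ _ that] by simp
  have F2_disjoint: "F 2 \<inter> F' 2 \<subseteq> {0}" using dims(1) by simp
  have "F 3 \<inter> F' 3 \<subseteq> {v. N *v v = 0}" using into2 into2' F2_disjoint by blast
  then have kernel_ge: "2 \<le> vec.dim {v. N *v v = 0}"
    using vec.dim_subset dims(2) by metis
  have ker3: "vec.dim {v \<in> F 3. N *v v = 0} = 2" "vec.dim {v \<in> F' 3. N *v v = 0} = 2"
    using complete_flag_JF_eq_2_1D(1)[OF flags(1) compatible(1)] complete_flag_JF_eq_2_1D(1)[OF flags(2) compatible(2)]
      g34 g43 growth_at_top[OF flags] by simp_all
  let ?I = "(*v) N ` F 3" and ?I' = "(*v) N ` F' 3"
  have I: "vec.subspace ?I" "vec.subspace ?I'" "vec.dim ?I = 1" "vec.dim ?I' = 1"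
    using vec.subspace_image[OF F3(1)] vec.subspace_image[OF F3(3)] F3(2,4) ker3
      dim_image_add_dim_kernel[OF matrix_vector_mul_linear_gen F3(1), of N]
      dim_image_add_dim_kernel[OF matrix_vector_mul_linear_gen F3(3), of N] by simp_all
  have "?I \<subseteq> F 2" "?I' \<subseteq> F' 2" using into2 into2' by auto
  then have "vec.dim (?I \<inter> ?I') = 0" using F2_disjoint by (simp add: subset_iff)
  then have dim_sum: "vec.dim {x + y |x y. x \<in> ?I \<and> y \<in> ?I'} = 2"
    using vec.dim_sums_Int[OF I(1,2)] I(3,4) by linarith
  have "{x + y |x y. x \<in> ?I \<and> y \<in> ?I'} \<subseteq> (*v) N ` UNIV"
    by (auto intro: rangeI simp flip: matrix_vector_right_distrib)
  from vec.dim_subset[OF this] have "2 \<le> vec.dim ((*v) N ` UNIV)" using dim_sum by simp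
  then have "vec.dim {v. N *v v = 0} \<le> 2" using dim_range_add_dim_kernel[of N] by linarith
  then show ?thesis
    using growth_44_eq_kernel_dim[OF om dims(2) g34 g43] kernel_ge by simp
qed

lemma subset_if_dim_Int_eq:
  assumes A: "vec.subspace A" and B: "vec.subspace B" and dim: "vec.dim (A \<inter> B) = vec.dim A"
  shows "A \<subseteq> B"
  using vec.subspace_dim_equal[OF vec.subspace_inter[OF A B] A] dim by auto

lemma rel_pos_1432_lines:
  assumes F: "complete_flag F" and F': "complete_flag F'"
    and rp: "rel_pos (perm_mat (one_line [1,4,3,2])) F F'"
  shows "F' 1 = F 1" and "F 2 \<inter> F' 3 = F 1" and "F 3 \<inter> F' 2 = F 1"
proof -
  note dims = rel_pos_dim_1432[OF rp]
  note sF = complete_flagD[OF F] and sF' = complete_flagD[OF F']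
  have "F 1 \<subseteq> F' 1" "F' 1 \<subseteq> F 1" "F 1 \<subseteq> F' 3"
    using subset_if_dim_Int_eq[OF sF(1) sF'(1), of 1 1] subset_if_dim_Int_eq[OF sF'(1) sF(1), of 1 1]
      subset_if_dim_Int_eq[OF sF(1) sF'(1), of 1 3] dims sF(2) sF'(2) by (simp_all add: Int_commute)
  then show F1: "F' 1 = F 1" by blast
  have "F 1 \<subseteq> F 2 \<inter> F' 3" "F 1 \<subseteq> F 3 \<inter> F' 2"
    using \<open>F 1 \<subseteq> F' 3\<close> F1 complete_flag_mono[OF F, of 1] complete_flag_mono[OF F', of 1] by auto
  then show "F 2 \<inter> F' 3 = F 1" "F 3 \<inter> F' 2 = F 1"
    using vec.subspace_dim_equal[OF sF(1) vec.subspace_inter[OF sF(1) sF'(1)], of 1 2 3]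
      vec.subspace_dim_equal[OF sF(1) vec.subspace_inter[OF sF(1) sF'(1)], of 1 3 2]
      dims sF(2) by auto
qed

text \<open>\<open>N F\<^sub>3 \<subseteq> F\<^sub>2\<close> lies in the kernel of \<open>N|\<^sub>F\<^sub>3\<close>, which is \<open>F\<^sub>3 \<inter> F'\<^sub>3\<close> because
  \<open>G\<^sub>3\<^sub>3 = (2)\<close>; so \<open>N F\<^sub>3 \<subseteq> F\<^sub>2 \<inter> F'\<^sub>3 = F\<^sub>1\<close>, and symmetrically for \<open>F'\<^sub>3\<close>.\<close>
lemma range_subset_1432:
  assumes om: "(F, F', N) \<in> Omega (perm_mat (one_line [1,4,3,2]))"
    and g33: "growth F F' N 3 3 = [2]"
    and g34: "growth F F' N 3 4 = [2, 1]" and g43: "growth F F' N 4 3 = [2, 1]"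
  shows "range ((*v) N) \<subseteq> F 1"
proof -
  note flags = OmegaD(1,2)[OF om] and compatible = OmegaD(4,5)[OF om]
  note dims = rel_pos_dim_1432[OF OmegaD(3)[OF om]]
  note lines = rel_pos_1432_lines[OF flags OmegaD(3)[OF om]]
  have F3: "vec.subspace (F 3)" "vec.dim (F 3) = 3" "vec.subspace (F' 3)" "vec.dim (F' 3) = 3"
    using complete_flagD[OF flags(1)] complete_flagD[OF flags(2)] by auto
  have stable: "\<forall>x\<in>F 3. N *v x \<in> F 3" and stable': "\<forall>x\<in>F' 3. N *v x \<in> F' 3"
    using strictly_compatible_stable[OF flags(1) compatible(1)]
      strictly_compatible_stable[OF flags(2) compatible(2)] by simp_all
  have JF3: "JF N (F 3) = [2, 1]" "JF N (F' 3) = [2, 1]"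
    using g34 g43 growth_at_top[OF flags] by simp_all
  define W where "W = F 3 \<inter> F' 3"
  have W: "vec.subspace W" "\<forall>w\<in>W. N *v w \<in> W" "vec.dim W = 2"
    unfolding W_def using vec.subspace_inter[OF F3(1,3)] dims(5) stable stable' by auto
  have "\<forall>w\<in>W. N *v w = 0"
    using JF_eq_2D[OF W] g33 unfolding W_def growth_def by simp
  then have "W \<subseteq> {v \<in> F 3. N *v v = 0}" "W \<subseteq> {v \<in> F' 3. N *v v = 0}"
    unfolding W_def by auto
  then have kernels: "W = {v \<in> F 3. N *v v = 0}" "W = {v \<in> F' 3. N *v v = 0}"
    using vec.subspace_dim_equal[OF W(1) subspace_kernel_on[OF matrix_vector_mul_linear_gen[of N] F3(1)]]
      vec.subspace_dim_equal[OF W(1) subspace_kernel_on[OF matrix_vector_mul_linear_gen[of N] F3(3)]]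
      complete_flag_JF_eq_2_1D(1)[OF flags(1) compatible(1) JF3(1)]
      complete_flag_JF_eq_2_1D(1)[OF flags(2) compatible(2) JF3(2)] W(3)
    by simp_all
  have sq: "\<forall>v\<in>F 3. N *v (N *v v) = 0" "\<forall>v\<in>F' 3. N *v (N *v v) = 0"
    using complete_flag_JF_eq_2_1D(2)[OF flags(1) compatible(1) JF3(1)]
      complete_flag_JF_eq_2_1D(2)[OF flags(2) compatible(2) JF3(2)]
    by simp_all
  have into1: "N *v x \<in> F 1" if "x \<in> F 3" for x
  proof -
    have "N *v x \<in> F 2" using strictly_compatibleD[OF compatible(1) _ _ that] by simp
    moreover have "N *v x \<in> W"
      using kernels(1) sq(1) that stable by blast
    ultimately show ?thesis using lines(2) unfolding W_def by blast
  qed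
  have into1': "N *v x \<in> F 1" if "x \<in> F' 3" for x
  proof -
    have "N *v x \<in> F' 2" using strictly_compatibleD[OF compatible(2) _ _ that] by simp
    moreover have "N *v x \<in> W"
      using kernels(2) sq(2) that stable' by blast
    ultimately show ?thesis using lines(3) unfolding W_def by blast
  qed
  have "\<exists>a\<in>F 3. \<exists>b\<in>F' 3. v = a + b" for v
    by (rule sum_decomposition_by_dim) (simp_all add: F3 dims(5))
  show ?thesis
  proof
    fix z assume "z \<in> range ((*v) N)"
    then obtain a b where "a \<in> F 3" "b \<in> F' 3" "z = N *v a + N *v b"
      using \<open>\<And>v. \<exists>a\<in>F 3. \<exists>b\<in>F' 3. v = a + b\<close> by (metis matrix_vector_right_distrib rangeE)
    then show "z \<in> F 1"
      using into1 into1' vec.subspace_add[OF complete_flagD(1)[OF flags(1), of 1]] by simp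
  qed
qed

lemma growth_44_1432:
  assumes om: "(F, F', N) \<in> Omega (perm_mat (one_line [1,4,3,2]))"
    and g33: "growth F F' N 3 3 = [2]"
    and g34: "growth F F' N 3 4 = [2, 1]" and g43: "growth F F' N 4 3 = [2, 1]"
  shows "growth F F' N 4 4 = [3, 1]"
proof -
  note flags = OmegaD(1,2)[OF om] and compatible = OmegaD(4,5)[OF om]
  let ?K = "{v. N *v v = 0}"
  have "vec.dim (range ((*v) N)) \<le> 1"
    using vec.dim_subset[OF range_subset_1432[OF assms]] complete_flagD(2)[OF flags(1), of 1] by simp
  then have "3 \<le> vec.dim ?K" using dim_range_add_dim_kernel[of N] by linarith
  moreover have "vec.dim ?K \<le> 4"
    using vec.dim_subset[of ?K UNIV] by (simp add: vec_dim_card del: vec.dim_UNIV)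
  moreover have "vec.dim ?K \<noteq> 4"
  proof
    assume "vec.dim ?K = 4"
    then have "?K = UNIV"
      using vec.subspace_dim_equal[OF subspace_kernel_on[OF matrix_vector_mul_linear_gen[of N]
            vec.subspace_UNIV] vec.subspace_UNIV]
      by (simp add: vec_dim_card del: vec.dim_UNIV)
    then have "{v \<in> F 3. N *v v = 0} = F 3" by auto
    then have "vec.dim {v \<in> F 3. N *v v = 0} = 3" using complete_flagD(2)[OF flags(1), of 3] by simp
    moreover have "vec.dim {v \<in> F 3. N *v v = 0} = 2"
      using complete_flag_JF_eq_2_1D(1)[OF flags(1) compatible(1)] g34 growth_at_top[OF flags] by simp
    ultimately show False by simp
  qed
  ultimately have "vec.dim ?K = 3" by linarith
  then show ?thesis
    using growth_44_eq_kernel_dim[OF om rel_pos_dim_1432(5)[OF OmegaD(3)[OF om]] g34 g43] by simp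
qed

section \<open>Coordinate flags realising both conditioning events\<close>

definition coord_subspace :: "'n set \<Rightarrow> ('a::field^'n) set" where
  "coord_subspace S = {x. \<forall>i. i \<notin> S \<longrightarrow> x $ i = 0}"

lemma subspace_coord_subspace: "vec.subspace (coord_subspace S)"
  unfolding coord_subspace_def vec.subspace_def by auto

lemma dim_coord_subspace: "vec.dim (coord_subspace S :: ('a::field^'n) set) = card S"
  unfolding coord_subspace_def by (rule dim_substandard_cart)

lemma coord_subspace_Int: "coord_subspace A \<inter> coord_subspace B = coord_subspace (A \<inter> B)"
  by (auto simp: coord_subspace_def)

lemma coord_subspace_mono: "A \<subseteq> B \<Longrightarrow> coord_subspace A \<subseteq> coord_subspace B"
  by (auto simp: coord_subspace_def)

lemma coord_subspace_empty: "coord_subspace {} = {0}"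
  by (auto simp: coord_subspace_def vec_eq_iff)

lemma coord_subspace_UNIV: "coord_subspace UNIV = UNIV"
  by (auto simp: coord_subspace_def)

definition coord_flag :: "'n list \<Rightarrow> nat \<Rightarrow> ('a::field^'n) set" where
  "coord_flag ws i = coord_subspace (set (take i ws))"

lemma complete_flag_coord_flag:
  assumes ws: "distinct ws" "set ws = (UNIV :: 4 set)"
  shows "complete_flag (coord_flag ws :: nat \<Rightarrow> ('a::field^4) set)"
proof -
  have "length ws = 4" using distinct_card[OF ws(1)] ws(2) by simp
  then have "card (set (take i ws)) = i" if "i \<le> 4" for i
    using that ws(1) by (simp add: distinct_card min_absorb2)
  moreover have "set (take i ws) \<subseteq> set (take (Suc i) ws)" for i
    by (simp add: set_take_subset_set_take)
  moreover have "take 4 ws = ws" using \<open>length ws = 4\<close> by simp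
  ultimately show ?thesis
    unfolding complete_flag_def coord_flag_def
    by (simp add: subspace_coord_subspace dim_coord_subspace coord_subspace_mono
        coord_subspace_empty coord_subspace_UNIV ws(2))
qed

lemma all_nat_le_4: "(\<forall>i\<le>(4::nat). P i) \<longleftrightarrow> P 0 \<and> P 1 \<and> P 2 \<and> P 3 \<and> P 4"
  by (simp add: numeral_eq_Suc le_Suc_eq all_conj_distrib)

lemma strictly_compatible_iff_4:
  "strictly_compatible N F \<longleftrightarrow>
    (*v) N ` F 1 \<subseteq> F 0 \<and> (*v) N ` F 2 \<subseteq> F 1 \<and> (*v) N ` F 3 \<subseteq> F 2 \<and> (*v) N ` F 4 \<subseteq> F 3"
  unfolding strictly_compatible_def by (auto simp: numeral_eq_Suc atLeastAtMostSuc_conv)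

lemma JF_coord_subspace_square_zero:
  assumes sq: "\<forall>v. N *v (N *v v) = 0" and S: "2 \<le> card S"
    and ker: "{v \<in> coord_subspace S. N *v v = 0} = coord_subspace T"
  shows "JF N (coord_subspace S) = filter ((<) 0) [card T, card S - card T]"
proof -
  have "ker_dim N (coord_subspace S) 1 = card T"
    unfolding ker_dim_1 ker dim_coord_subspace ..
  then show ?thesis
    using JF_square_zero[OF subspace_coord_subspace, of S N] sq S by (simp add: dim_coord_subspace)
qed

definition N_3412 :: "'a::field^4^4" where
  "N_3412 = (\<chi> i j. if (i = 1 \<and> j = 2) \<or> (i = 3 \<and> j = 4) then 1 else 0)"

lemma N_3412_apply: "N_3412 *v x = (\<chi> i. if i = 1 then x $ 2 else if i = 3 then x $ 4 else 0)"
  unfolding N_3412_def matrix_vector_mult_def vec_eq_iff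
proof
  fix i :: 4
  show "(\<chi> i. \<Sum>j\<in>UNIV. (\<chi> i j. if i = 1 \<and> j = 2 \<or> i = 3 \<and> j = 4 then 1 else 0) $ i $ j * x $ j) $ i =
        (\<chi> i. if i = 1 then x $ 2 else if i = 3 then x $ 4 else 0) $ i"
    unfolding UNIV_4 using exhaust_4[of i] by auto
qed

lemma N_3412_image:
  "(2 \<in> A \<longrightarrow> 1 \<in> B) \<Longrightarrow> (4 \<in> A \<longrightarrow> 3 \<in> B) \<Longrightarrow>
    (*v) N_3412 ` coord_subspace A \<subseteq> (coord_subspace B :: ('a::field^4) set)"
  unfolding coord_subspace_def N_3412_apply by auto

lemma N_3412_square_zero: "N_3412 *v (N_3412 *v v) = 0"
  unfolding N_3412_apply vec_eq_iff by simp

lemma N_3412_kernel: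
  "{v \<in> coord_subspace A. N_3412 *v v = 0} = (coord_subspace (A - {2, 4}) :: ('a::field^4) set)"
  unfolding coord_subspace_def N_3412_apply vec_eq_iff forall_4 by auto

lemma Omega_3412_growth_witness:
  "\<exists>(F, F', N) \<in> (Omega (perm_mat (one_line [3,4,1,2])) :: ((nat \<Rightarrow> ('a::field^4) set) \<times> _ \<times> _) set).
     growth F F' N 3 3 = [2] \<and> growth F F' N 3 4 = [2, 1] \<and> growth F F' N 4 3 = [2, 1]"
proof -
  let ?F = "coord_flag [1,2,3,4] :: nat \<Rightarrow> ('a^4) set" and ?F' = "coord_flag [3,4,1,2]"
  have "complete_flag ?F" by (rule complete_flag_coord_flag) (simp, auto simp: UNIV_4)
  moreover have "complete_flag ?F'" by (rule complete_flag_coord_flag) (simp, auto simp: UNIV_4)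
  moreover have "rel_pos (perm_mat (one_line [3,4,1,2])) ?F ?F'"
    unfolding rel_pos_def all_nat_le_4 coord_flag_def coord_subspace_Int dim_coord_subspace
    by (simp add: perm_mat_def one_line_def eval_nat_numeral sum.atLeast_Suc_atMost)
  moreover have "strictly_compatible N_3412 ?F" "strictly_compatible N_3412 ?F'"
    unfolding strictly_compatible_iff_4 coord_flag_def by (simp_all add: N_3412_image)
  moreover have "growth ?F ?F' N_3412 3 3 = [2]" "growth ?F ?F' N_3412 3 4 = [2, 1]"
    "growth ?F ?F' N_3412 4 3 = [2, 1]"
    unfolding growth_def coord_flag_def coord_subspace_Int
    by (simp_all add: JF_coord_subspace_square_zero[OF allI[OF N_3412_square_zero] _ N_3412_kernel])
  ultimately show ?thesis unfolding Omega_def by blast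
qed

definition N_1432 :: "'a::field^4^4" where
  "N_1432 = (\<chi> i j. if i = 1 \<and> (j = 2 \<or> j = 4) then 1 else 0)"

lemma N_1432_apply: "N_1432 *v x = (\<chi> i. if i = 1 then x $ 2 + x $ 4 else 0)"
  unfolding N_1432_def matrix_vector_mult_def vec_eq_iff
proof
  fix i :: 4
  show "(\<chi> i. \<Sum>j\<in>UNIV. (\<chi> i j. if i = 1 \<and> (j = 2 \<or> j = 4) then 1 else 0) $ i $ j * x $ j) $ i =
        (\<chi> i. if i = 1 then x $ 2 + x $ 4 else 0) $ i"
    unfolding UNIV_4 using exhaust_4[of i] by auto
qed

lemma N_1432_image:
  "(2 \<in> A \<or> 4 \<in> A \<longrightarrow> 1 \<in> B) \<Longrightarrow>
    (*v) N_1432 ` coord_subspace A \<subseteq> (coord_subspace B :: ('a::field^4) set)"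
  unfolding coord_subspace_def N_1432_apply by auto

lemma N_1432_square_zero: "N_1432 *v (N_1432 *v v) = 0"
  unfolding N_1432_apply vec_eq_iff by simp

lemma N_1432_kernel:
  "\<not> (2 \<in> A \<and> 4 \<in> A) \<Longrightarrow>
    {v \<in> coord_subspace A. N_1432 *v v = 0} = (coord_subspace (A - {2, 4}) :: ('a::field^4) set)"
  unfolding coord_subspace_def N_1432_apply vec_eq_iff forall_4 by auto

lemma Omega_1432_growth_witness:
  "\<exists>(F, F', N) \<in> (Omega (perm_mat (one_line [1,4,3,2])) :: ((nat \<Rightarrow> ('a::field^4) set) \<times> _ \<times> _) set).
     growth F F' N 3 3 = [2] \<and> growth F F' N 3 4 = [2, 1] \<and> growth F F' N 4 3 = [2, 1]"
proof -
  let ?F = "coord_flag [1,2,3,4] :: nat \<Rightarrow> ('a^4) set" and ?F' = "coord_flag [1,4,3,2]"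
  have "complete_flag ?F" by (rule complete_flag_coord_flag) (simp, auto simp: UNIV_4)
  moreover have "complete_flag ?F'" by (rule complete_flag_coord_flag) (simp, auto simp: UNIV_4)
  moreover have "rel_pos (perm_mat (one_line [1,4,3,2])) ?F ?F'"
    unfolding rel_pos_def all_nat_le_4 coord_flag_def coord_subspace_Int dim_coord_subspace
    by (simp add: perm_mat_def one_line_def eval_nat_numeral sum.atLeast_Suc_atMost)
  moreover have "strictly_compatible N_1432 ?F" "strictly_compatible N_1432 ?F'"
    unfolding strictly_compatible_iff_4 coord_flag_def by (simp_all add: N_1432_image)
  moreover have "growth ?F ?F' N_1432 3 3 = [2]" "growth ?F ?F' N_1432 3 4 = [2, 1]"
    "growth ?F ?F' N_1432 4 3 = [2, 1]"
    unfolding growth_def coord_flag_def coord_subspace_Int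
    by (simp_all add: JF_coord_subspace_square_zero[OF allI[OF N_1432_square_zero] _ N_1432_kernel])
  ultimately show ?thesis unfolding Omega_def by blast
qed

theorem proposition7p23:
  assumes "\<exists>p k. prime (p::nat) \<and> k > 0 \<and> CARD('k::{field,finite}) = p ^ k"
  shows
    "(\<exists>(F, F', N) \<in> (Omega (perm_mat (one_line [3,4,1,2])) :: ((nat \<Rightarrow> ('k^4) set) \<times> _ \<times> _) set).
        growth F F' N 3 3 = [2] \<and> growth F F' N 3 4 = [2,1] \<and> growth F F' N 4 3 = [2,1])
   \<and> (\<forall>(F, F', N) \<in> (Omega (perm_mat (one_line [3,4,1,2])) :: ((nat \<Rightarrow> ('k^4) set) \<times> _ \<times> _) set).
        growth F F' N 3 3 = [2] \<and> growth F F' N 3 4 = [2,1] \<and> growth F F' N 4 3 = [2,1]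
        \<longrightarrow> growth F F' N 4 4 = [2,2])
   \<and> (\<exists>(F, F', N) \<in> (Omega (perm_mat (one_line [1,4,3,2])) :: ((nat \<Rightarrow> ('k^4) set) \<times> _ \<times> _) set).
        growth F F' N 3 3 = [2] \<and> growth F F' N 3 4 = [2,1] \<and> growth F F' N 4 3 = [2,1])
   \<and> (\<forall>(F, F', N) \<in> (Omega (perm_mat (one_line [1,4,3,2])) :: ((nat \<Rightarrow> ('k^4) set) \<times> _ \<times> _) set).
        growth F F' N 3 3 = [2] \<and> growth F F' N 3 4 = [2,1] \<and> growth F F' N 4 3 = [2,1]
        \<longrightarrow> growth F F' N 4 4 = [3,1])"
  using Omega_3412_growth_witness growth_44_3412 Omega_1432_growth_witness growth_44_1432 by blast

end
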